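(* Let $(\varepsilon_n)_{n=1}^\infty$ be a sequence of strictly positive real numbers with $L:=\sup_{n\ge1}\varepsilon_n<1$, and put $\varepsilon_0=0$. Let $(\alpha_n)_{n=1}^\infty$ be a sequence of strictly positive real numbers with $\alpha_{n+1}\ge\left(1+\frac{L}{n}\right)\alpha_n$ for all $n\ge1$ and $\alpha_n/n\to0$. Let $(d_n)_{n=1}^\infty$ be a sequence of strictly positive real numbers such that $0<d_1\le\alpha_1$ and, for all $n\ge1$ and all $1\le k\le n+1$, $$d_n\,\frac{1+\varepsilon_{k-1}/n}{1+\varepsilon_k/(n+2)}<d_{n+1}\le\alpha_{n+1}.$$ Set $d_{1,1}=d_1+\frac{\varepsilon_1 d_1}{2}$ and, for all $n\ge1$ and $1\le k\le n+1$, $$d_{k,n+1}=\frac{d_{n+1}-d_n}{n+1}+\frac{\varepsilon_k d_{n+1}}{(n+1)(n+2)}-\frac{\varepsilon_{k-1}d_n}{n(n+1)}.$$ Then the diagonal operator $D=\bigoplus_{n\ge1}D_n$, where $D_n=\operatorname{diag}(d_{k,n})_{k=1}^n$, is strictly positive and is a commutator of compact operators, i.e. all $d_{k,n}$ ($1\le k\le n$) are strictly positive and there exist compact operators $C,Z$ with $D=CZ-ZC$. Moreover, as the data range over all triples of sequences of strictly positive real numbers $(\varepsilon_n)_{n=1}^\infty,(\alpha_n)_{n=1}^\infty,(d_n)_{n=1}^\infty$ such that (with $\varepsilon_0=0$) $L=\sup_{n\ge1}\varepsilon_n<1$, $\alpha_{n+1}\ge\left(1+\frac{L}{n}\right)\alpha_n$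 for all $n\ge1$, $\alpha_n/n\to0$, $0<d_1\le\alpha_1$, and $d_n\,\frac{1+\varepsilon_{k-1}/n}{1+\varepsilon_k/(n+2)}<d_{n+1}\le\alpha_{n+1}$ for all $n\ge1$ and all $1\le k\le n+1$, there are uncountably many operators $D$ so obtained for which all the diagonal entries $d_{k,n}$ ($n\ge1$, $1\le k\le n$) are distinct.
   Context: Operators act on an infinite dimensional separable complex Hilbert space. $D=\bigoplus D_n$ is the diagonal operator, in a fixed orthonormal basis, whose consecutive diagonal entries are those of $D_1$ ($1\times1$), $D_2$ ($2\times 2$), $D_3$ ($3\times3$), and so on. "Strictly positive" for a diagonal operator means that all its diagonal entries are strictly positive. *)

theory Defs
  imports "HOL-Analysis.Analysis" "HOL-Library.Nat_Bijection"
begin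

text \<open>
  Complex Hilbert spaces. Norm, metric and completeness are those of the underlying real Hilbert
  space; the class adds the complex scalars and the complex inner product (linear in the second
  argument), and requires that they induce the given real structure. Positive definiteness and
  \<open>norm x = sqrt (Re (cinner x x))\<close> are then inherited from \<^class>\<open>real_inner\<close>.
\<close>

class complex_hilbert = real_inner + complete_space +
  fixes scaleC :: "complex \<Rightarrow> 'a \<Rightarrow> 'a"  (infixr \<open>*\<^sub>C\<close> 75)
    and cinner :: "'a \<Rightarrow> 'a \<Rightarrow> complex"
  assumes scaleC_add_right: "c *\<^sub>C (x + y) = c *\<^sub>C x + c *\<^sub>C y"
    and scaleC_add_left: "(b + c) *\<^sub>C x = b *\<^sub>C x + c *\<^sub>C x"
    and scaleC_scaleC: "b *\<^sub>C c *\<^sub>C x = (b * c) *\<^sub>C x"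
    and scaleC_one: "1 *\<^sub>C x = x"
    and scaleR_eq_scaleC: "scaleR r x = complex_of_real r *\<^sub>C x"
    and cinner_commute: "cinner x y = cnj (cinner y x)"
    and cinner_add_right: "cinner x (y + z) = cinner x y + cinner x z"
    and cinner_scaleC_right: "cinner x (c *\<^sub>C y) = c * cinner x y"
    and inner_eq_Re_cinner: "inner x y = Re (cinner x y)"

lemma vector_space_scaleC: "vector_space (scaleC :: complex \<Rightarrow> 'a \<Rightarrow> 'a::complex_hilbert)"
  by unfold_locales
    (simp_all add: scaleC_add_right scaleC_add_left scaleC_scaleC scaleC_one)

text \<open>
  An orthonormal basis indexed by \<^typ>\<open>nat\<close>; a space that has one is automatically separable and
  infinite dimensional, and every such space has one. \<open>module.span scaleC\<close> is the complex linear
  span.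
\<close>

definition orthonormal_basis :: "(nat \<Rightarrow> 'a::complex_hilbert) \<Rightarrow> bool" where
  "orthonormal_basis e \<longleftrightarrow>
     (\<forall>i j. cinner (e i) (e j) = (if i = j then 1 else 0)) \<and>
     closure (module.span scaleC (range e)) = UNIV"

definition clinear_op :: "('a::complex_hilbert \<Rightarrow> 'a) \<Rightarrow> bool" where
  "clinear_op T \<longleftrightarrow> Vector_Spaces.linear scaleC scaleC T"

definition bounded_op :: "('a::complex_hilbert \<Rightarrow> 'a) \<Rightarrow> bool" where
  "bounded_op T \<longleftrightarrow> clinear_op T \<and> (\<exists>K. \<forall>x. norm (T x) \<le> K * norm x)"

definition compact_op :: "('a::complex_hilbert \<Rightarrow> 'a) \<Rightarrow> bool" where
  "compact_op T \<longleftrightarrow> clinear_op T \<and> compact (closure (T ` cball 0 1))"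

definition commutator_of_compacts :: "('a::complex_hilbert \<Rightarrow> 'a) \<Rightarrow> bool" where
  "commutator_of_compacts T \<longleftrightarrow>
     (\<exists>C Z. compact_op C \<and> compact_op Z \<and> T = (\<lambda>x. C (Z x) - Z (C x)))"

text \<open>
  Blocks are numbered from 1, the \<open>n\<close>-th one having size \<open>n\<close>, while the basis is indexed from 0.
  Hence the \<open>k\<close>-th place (\<open>1 \<le> k \<le> n\<close>) of the \<open>n\<close>-th block is the basis index
  \<open>(1 + \<dots> + (n - 1)) + (k - 1)\<close>.
\<close>

definition block_places :: "(nat \<times> nat) set" where
  "block_places = {(k, n). 1 \<le> k \<and> k \<le> n}"

definition block_index :: "nat \<Rightarrow> nat \<Rightarrow> nat" where
  "block_index k n = n * (n - 1) div 2 + (k - 1)"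

lemma bij_betw_block_index: "bij_betw (\<lambda>(k, n). block_index k n) block_places UNIV"
proof -
  have "bij_betw (\<lambda>(k, n). (k - 1, n - k)) block_places UNIV"
    by (rule bij_betw_byWitness[where f' = "\<lambda>(i, j). (i + 1, i + 1 + j)"])
      (auto simp: block_places_def)
  then have "bij_betw (prod_encode \<circ> (\<lambda>(k, n). (k - 1, n - k))) block_places UNIV"
    by (rule bij_betw_trans) (rule bij_prod_encode)
  moreover have "(prod_encode \<circ> (\<lambda>(k, n). (k - 1, n - k))) p = (\<lambda>(k, n). block_index k n) p"
    if p: "p \<in> block_places" for p
  proof -
    obtain k m where "p = (k, Suc m)" "1 \<le> k" "k \<le> Suc m"
      using p by (cases p, cases "snd p") (auto simp: block_places_def)
    then show ?thesis
      by (simp add: block_index_def prod_encode_def triangle_def mult.commute)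
  qed
  ultimately show ?thesis by (simp cong: bij_betw_cong)
qed

text \<open>
  \<open>D\<close> is the direct sum over \<open>n \<ge> 1\<close> of the diagonal matrices with entries \<open>a k n\<close>, \<open>1 \<le> k \<le> n\<close>,
  as an operator on the whole space; it is determined by \<open>e\<close> and \<open>a\<close>.
\<close>

definition block_diagonal_op ::
    "(nat \<Rightarrow> 'a::complex_hilbert) \<Rightarrow> (nat \<Rightarrow> nat \<Rightarrow> real) \<Rightarrow> ('a \<Rightarrow> 'a) \<Rightarrow> bool" where
  "block_diagonal_op e a D \<longleftrightarrow> bounded_op D \<and>
     (\<forall>(k, n) \<in> block_places.
        D (e (block_index k n)) = complex_of_real (a k n) *\<^sub>C e (block_index k n))"

lemma block_diagonal_op_unique:
  assumes e: "orthonormal_basis e"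
    and D: "block_diagonal_op e a D" and D': "block_diagonal_op e a D'"
  shows "D = D'"
proof -
  interpret V: vector_space "scaleC :: complex \<Rightarrow> 'a \<Rightarrow> 'a"
    by (rule vector_space_scaleC)
  have lin: "Vector_Spaces.linear scaleC scaleC T" and cont: "continuous_on UNIV T"
    if T: "block_diagonal_op e a T" for T
  proof -
    show l: "Vector_Spaces.linear scaleC scaleC T"
      using T by (simp add: block_diagonal_op_def bounded_op_def clinear_op_def)
    interpret T: Vector_Spaces.linear scaleC scaleC T by (rule l)
    obtain K where K: "\<And>x. norm (T x) \<le> K * norm x"
      using T unfolding block_diagonal_op_def bounded_op_def by blast
    have "bounded_linear T"
      by (rule bounded_linear_intro[where K = K])
        (use K in \<open>auto simp: T.add T.scale scaleR_eq_scaleC mult.commute\<close>)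
    then show "continuous_on UNIV T"
      by (rule bounded_linear.continuous_on) (rule continuous_on_id)
  qed
  have basis: "D (e i) = D' (e i)" for i
  proof -
    obtain k n where "(k, n) \<in> block_places" "i = block_index k n"
      using bij_betw_imp_surj_on[OF bij_betw_block_index] by (metis UNIV_I imageE case_prod_conv surj_pair)
    then show ?thesis using D D' by (fastforce simp: block_diagonal_op_def)
  qed
  interpret P: vector_space_pair "scaleC :: complex \<Rightarrow> 'a \<Rightarrow> 'a" "scaleC :: complex \<Rightarrow> 'a \<Rightarrow> 'a" ..
  have span: "D x = D' x" if "x \<in> V.span (range e)" for x
    by (rule P.linear_eq_on_span[OF lin[OF D] lin[OF D'] _ that]) (use basis in auto)
  have "closed {x. D x = D' x}"
    by (rule closed_Collect_eq) (use cont D D' in auto)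
  then have "closure (V.span (range e)) \<subseteq> {x. D x = D' x}"
    by (rule closure_minimal[rotated]) (use span in auto)
  then show ?thesis using e by (auto simp: orthonormal_basis_def)
qed

text \<open>
  In all sequences the terms with index at least 1 are the data of the problem; \<open>\<epsilon> 0 = 0\<close> is the
  convention used in the formulas, and \<open>\<alpha> 0\<close>, \<open>d 0\<close> are never used. \<^const>\<open>Sup\<close> on \<^typ>\<open>real\<close> is
  meaningful only for bounded sets, whence the explicit \<^const>\<open>bdd_above\<close>.
\<close>

definition admissible :: "(nat \<Rightarrow> real) \<Rightarrow> (nat \<Rightarrow> real) \<Rightarrow> (nat \<Rightarrow> real) \<Rightarrow> bool" where
  "admissible \<epsilon> \<alpha> d \<longleftrightarrow>
     \<epsilon> 0 = 0 \<and>
     (\<forall>n\<ge>1. 0 < \<epsilon> n) \<and> (\<forall>n\<ge>1. 0 < \<alpha> n) \<and> (\<forall>n\<ge>1. 0 < d n) \<and>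
     bdd_above (\<epsilon> ` {1..}) \<and> (SUP n\<in>{1..}. \<epsilon> n) < 1 \<and>
     (\<forall>n\<ge>1. \<alpha> (n + 1) \<ge> (1 + (SUP m\<in>{1..}. \<epsilon> m) / real n) * \<alpha> n) \<and>
     (\<lambda>n. \<alpha> n / real n) \<longlonglongrightarrow> 0 \<and>
     d 1 \<le> \<alpha> 1 \<and>
     (\<forall>n\<ge>1. \<forall>k\<in>{1..n + 1}.
        d n * ((1 + \<epsilon> (k - 1) / real n) / (1 + \<epsilon> k / real (n + 2))) < d (n + 1) \<and>
        d (n + 1) \<le> \<alpha> (n + 1))"

text \<open>
  \<open>entry \<epsilon> d k m\<close> is \<open>d\<^bsub>k,m\<^esub>\<close>, relevant only for \<open>1 \<le> k \<le> m\<close>.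
\<close>

definition entry :: "(nat \<Rightarrow> real) \<Rightarrow> (nat \<Rightarrow> real) \<Rightarrow> nat \<Rightarrow> nat \<Rightarrow> real" where
  "entry \<epsilon> d k m =
     (if m \<le> 1 then d 1 + \<epsilon> 1 * d 1 / 2
      else let n = m - 1 in
        (d (n + 1) - d n) / real (n + 1)
        + \<epsilon> k * d (n + 1) / (real (n + 1) * real (n + 2))
        - \<epsilon> (k - 1) * d n / (real n * real (n + 1)))"

end

theory Submission
  imports Defs
begin

text \<open>
  Write \<open>f\<^bsub>k,n\<^esub>\<close> for the basis vector at the \<open>k\<close>-th place of the \<open>n\<close>-th block, and picture the places
  as a triangular array with an edge from \<open>(k, n)\<close> to \<open>(k, n + 1)\<close> (vertical) and one to
  \<open>(k + 1, n + 1)\<close> (diagonal). Give these edges the nonnegative weights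
  \<open>p\<^bsub>k,n\<^esub> = d\<^bsub>n\<^esub> (n + 1 - k) / (n (n + 1))\<close> and \<open>q\<^bsub>k,n\<^esub> = d\<^bsub>n\<^esub> (k + \<epsilon>\<^bsub>k\<^esub>) / (n (n + 1))\<close>.
  Let \<open>U\<close> and \<open>V\<close> be the weighted shifts that move a basis vector along its vertical and its
  diagonal edge, with the square roots of the weights as factors, and put
  \<open>C = U + V\<^sup>*\<close> and \<open>Z = V - U\<^sup>*\<close>. Then
  \<open>C Z - Z C = (U\<^sup>* U - U U\<^sup>*) + (V\<^sup>* V - V V\<^sup>*) + (U V - V U) + (U\<^sup>* V\<^sup>* - V\<^sup>* U\<^sup>*)\<close>.

  The weights make the last two brackets vanish: around each square of the array the product
  \<open>p\<^bsub>k,n\<^esub> q\<^bsub>k,n+1\<^esub>\<close> along one way equals \<open>q\<^bsub>k,n\<^esub> p\<^bsub>k+1,n+1\<^esub>\<close> along the other (\<open>weights_commute\<close>), so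
  \<open>U\<close> and \<open>V\<close> commute. The first two brackets are diagonal, and their entry at a place is the
  weight of the edges that leave it minus the weight of the edges that enter it, which is
  \<open>d\<^bsub>k,n\<^esub>\<close> (\<open>entry_eq_weights\<close>). Both weights are at most \<open>\<alpha>\<^bsub>n\<^esub> / n\<close>, which tends to 0, so all four
  shifts are compact (\<open>compact_block_shift\<close>). Positivity of \<open>d\<^bsub>k,n\<^esub>\<close> is the lower bound on
  \<open>d\<^bsub>n+1\<^esub>\<close>, rewritten (\<open>entry_pos\<close>).

  For the uncountable family, let \<open>\<epsilon>\<^bsub>k\<^esub> = t / 3\<^sup>k\<close> with \<open>0 < t < 1\<close> and
  \<open>d\<^bsub>n\<^esub> = \<alpha>\<^bsub>n\<^esub> = sqrt n\<close>. Each entry is an affine function of \<open>t\<close>; the constant term determines the block,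
  and the slope then determines the place in the block. So two different entries agree for
  at most one \<open>t\<close>, and there are countably many pairs of entries: all but countably many \<open>t\<close> give
  distinct entries. Different \<open>t\<close> give different operators, because the first entry is
  \<open>1 + t / 6\<close>.
\<close>

section \<open>Complex inner products\<close>

instance complex_hilbert \<subseteq> banach ..

lemma cinner_add_left: "cinner (x + y) z = cinner x z + cinner y (z :: 'a::complex_hilbert)"
  by (metis cinner_commute cinner_add_right complex_cnj_add)

lemma cinner_scaleC_left: "cinner (c *\<^sub>C x) y = cnj c * cinner x (y :: 'a::complex_hilbert)"
  by (metis cinner_commute cinner_scaleC_right complex_cnj_mult)

lemma cinner_zero_right: "cinner x (0 :: 'a::complex_hilbert) = 0"
  using cinner_add_right[of x 0 0] by simp

lemma cinner_sum_right:
  "cinner (x :: 'a::complex_hilbert) (\<Sum>i\<in>F. g i) = (\<Sum>i\<in>F. cinner x (g i))"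
  by (induction F rule: infinite_finite_induct) (auto simp: cinner_add_right cinner_zero_right)

lemma cinner_diff_right:
  "cinner (x :: 'a::complex_hilbert) (y - z) = cinner x y - cinner x z"
  using cinner_add_right[of x "y - z" z] by simp

lemma cinner_self: "cinner x x = complex_of_real ((norm (x :: 'a::complex_hilbert))\<^sup>2)"
proof -
  have "Im (cinner x x) = 0"
    using arg_cong[OF cinner_commute[of x x], of Im] by simp
  then show ?thesis
    by (simp add: complex_eq_iff power2_norm_eq_inner inner_eq_Re_cinner)
qed

lemma norm_scaleC: "norm (c *\<^sub>C x) = cmod c * norm (x :: 'a::complex_hilbert)"
proof -
  have "c * (cnj c * complex_of_real ((norm x)\<^sup>2)) = complex_of_real ((cmod c * norm x)\<^sup>2)"
    by (simp only: power_mult_distrib of_real_mult complex_norm_square mult_ac)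
  then have "complex_of_real ((norm (c *\<^sub>C x))\<^sup>2) = complex_of_real ((cmod c * norm x)\<^sup>2)"
    unfolding cinner_self[symmetric] cinner_scaleC_left cinner_scaleC_right
    by (simp only: cinner_self)
  then have "(norm (c *\<^sub>C x))\<^sup>2 = (cmod c * norm x)\<^sup>2"
    using of_real_eq_iff by blast
  then show ?thesis
    by (simp add: power2_eq_iff_nonneg)
qed

lemma bounded_linear_scaleC: "bounded_linear (\<lambda>x :: 'a::complex_hilbert. c *\<^sub>C x)"
  by (rule bounded_linear_intro[where K = "cmod c"])
    (simp_all add: scaleC_add_right scaleR_eq_scaleC scaleC_scaleC norm_scaleC mult.commute)

lemma bounded_linear_scaleC_left: "bounded_linear (\<lambda>c. c *\<^sub>C (x :: 'a::complex_hilbert))"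
  by (rule bounded_linear_intro[where K = "norm x"])
    (simp_all add: scaleC_add_left scaleR_eq_scaleC scaleC_scaleC norm_scaleC scaleR_conv_of_real)

definition orthonormal :: "('i \<Rightarrow> 'a::complex_hilbert) \<Rightarrow> bool" where
  "orthonormal u \<longleftrightarrow> (\<forall>i j. cinner (u i) (u j) = (if i = j then 1 else 0))"

lemma orthonormal_compose: "orthonormal u \<Longrightarrow> inj s \<Longrightarrow> orthonormal (\<lambda>i. u (s i))"
  by (simp add: orthonormal_def inj_eq)

lemma norm_sum_orthonormal:
  assumes u: "orthonormal u" and F: "finite F"
  shows "(norm (\<Sum>i\<in>F. c i *\<^sub>C u i))\<^sup>2 = (\<Sum>i\<in>F. (cmod (c i))\<^sup>2)"
  using F
proof induction
  case (insert j F)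
  have "cinner (c j *\<^sub>C u j) (\<Sum>i\<in>F. c i *\<^sub>C u i) = 0"
    using insert.hyps u
    by (auto simp: cinner_sum_right cinner_scaleC_left cinner_scaleC_right orthonormal_def
        intro!: sum.neutral)
  moreover have "norm (u j) = 1"
    using u by (simp add: norm_eq_1 inner_eq_Re_cinner orthonormal_def)
  ultimately show ?case
    using insert
    by (simp add: norm_add_Pythagorean orthogonal_def inner_eq_Re_cinner norm_scaleC)
qed simp

text \<open>
  The sum \<open>y\<close> of the components of \<open>x\<close> is orthogonal to \<open>x - y\<close>, so that Pythagoras
  applies to \<open>x = (x - y) + y\<close>.
\<close>
lemma Bessel_inequality:
  assumes u: "orthonormal u" and F: "finite F"
  shows "(\<Sum>i\<in>F. (cmod (cinner (u i) x))\<^sup>2) \<le> (norm x)\<^sup>2"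
proof -
  define y where "y = (\<Sum>i\<in>F. cinner (u i) x *\<^sub>C u i)"
  have "cinner (x - y) (u j) = 0" if "j \<in> F" for j
  proof -
    have "cinner (u j) y = (\<Sum>i\<in>F. if i = j then cinner (u i) x else 0)"
      using u unfolding y_def cinner_sum_right cinner_scaleC_right orthonormal_def
      by (intro sum.cong) auto
    then have "cinner (u j) (x - y) = 0"
      using F that by (simp add: cinner_diff_right)
    then show ?thesis
      by (metis cinner_commute complex_cnj_zero)
  qed
  then have "cinner (x - y) y = 0"
    by (subst (2) y_def) (simp add: cinner_sum_right cinner_scaleC_right)
  then have "(norm x)\<^sup>2 = (norm (x - y))\<^sup>2 + (norm y)\<^sup>2"
    using norm_add_Pythagorean[of "x - y" y] by (simp add: orthogonal_def inner_eq_Re_cinner)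
  then show ?thesis
    using norm_sum_orthonormal[OF u F, of "\<lambda>i. cinner (u i) x"] by (simp add: y_def)
qed

section \<open>Compact operators\<close>

lemma clinear_opI:
  assumes "\<And>x y. T (x + y) = T x + T y" and "\<And>c x. T (c *\<^sub>C x) = c *\<^sub>C T x"
  shows "clinear_op T"
proof -
  interpret V: vector_space "scaleC :: complex \<Rightarrow> 'a \<Rightarrow> 'a"
    by (rule vector_space_scaleC)
  show ?thesis
    unfolding clinear_op_def by unfold_locales (simp_all add: assms)
qed

lemma clinear_op_add: "clinear_op T \<Longrightarrow> T (x + y) = T x + T y"
  unfolding clinear_op_def Vector_Spaces.linear_def module_hom_def module_hom_axioms_def by blast

lemma clinear_op_scaleC: "clinear_op T \<Longrightarrow> T (c *\<^sub>C x) = c *\<^sub>C T x"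
  unfolding clinear_op_def Vector_Spaces.linear_def module_hom_def module_hom_axioms_def by blast

lemma clinear_op_linear: "clinear_op T \<Longrightarrow> linear T"
  by (rule linearI) (simp_all add: clinear_op_add clinear_op_scaleC scaleR_eq_scaleC)

lemma scaleC_diff_right: "c *\<^sub>C (x - y) = c *\<^sub>C x - c *\<^sub>C (y :: 'a::complex_hilbert)"
  using scaleC_add_right[of c "x - y" y] by (simp add: eq_diff_eq)

lemma compact_opI:
  assumes "clinear_op T" and "T ` cball 0 1 \<subseteq> S" and "compact S"
  shows "compact_op T"
proof -
  have "closure (T ` cball 0 1) \<subseteq> S"
    using assms by (intro closure_minimal compact_imp_closed)
  then show ?thesis
    using assms unfolding compact_op_def by (metis closed_closure compact_Int_closed inf.absorb_iff2)
qed

lemma compact_op_image: "compact_op T \<Longrightarrow> x \<in> cball 0 1 \<Longrightarrow> T x \<in> closure (T ` cball 0 1)"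
  by (meson closure_subset imageI subsetD)

lemma compact_op_plus:
  assumes S: "compact_op S" and T: "compact_op T"
  shows "compact_op (\<lambda>x. S x + T x)"
proof (rule compact_opI)
  show "clinear_op (\<lambda>x. S x + T x)"
    using S T by (intro clinear_opI)
      (simp_all add: compact_op_def clinear_op_add clinear_op_scaleC scaleC_add_right)
  show "compact {x + y |x y. x \<in> closure (S ` cball 0 1) \<and> y \<in> closure (T ` cball 0 1)}"
    using S T by (intro compact_sums) (simp_all add: compact_op_def)
qed (use compact_op_image[OF S] compact_op_image[OF T] in blast)

lemma compact_op_minus:
  assumes S: "compact_op S" and T: "compact_op T"
  shows "compact_op (\<lambda>x. S x - T x)"
proof (rule compact_opI)
  show "clinear_op (\<lambda>x. S x - T x)"
    using S T by (intro clinear_opI)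
      (simp_all add: compact_op_def clinear_op_add clinear_op_scaleC scaleC_diff_right)
  show "compact {x - y |x y. x \<in> closure (S ` cball 0 1) \<and> y \<in> closure (T ` cball 0 1)}"
    using S T by (intro compact_differences) (simp_all add: compact_op_def)
qed (use compact_op_image[OF S] compact_op_image[OF T] in blast)

lemma compact_op_bound:
  assumes "compact_op T"
  obtains K where "0 \<le> K" "\<And>x. norm (T x) \<le> K * norm x"
proof -
  interpret linear T
    using assms by (simp add: compact_op_def clinear_op_linear)
  have "bounded (T ` cball 0 1)"
    using assms by (meson bounded_subset closure_subset compact_imp_bounded compact_op_def)
  then obtain K where K: "\<And>x. x \<in> cball 0 1 \<Longrightarrow> norm (T x) \<le> K"
    unfolding bounded_iff by blast
  have "norm (T x) \<le> K * norm x" for x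
  proof (cases "x = 0")
    case False
    then have "norm (T x) / norm x \<le> K"
      using K[of "x /\<^sub>R norm x"] by (simp add: scale divide_inverse_commute)
    then show ?thesis
      using False by (simp add: divide_simps)
  qed (simp add: zero)
  moreover have "0 \<le> K"
    using K[of 0] by (simp add: zero)
  ultimately show ?thesis
    using that by blast
qed

lemma bounded_op_commutator:
  assumes S: "compact_op S" and T: "compact_op T"
  shows "bounded_op (\<lambda>x. S (T x) - T (S x))"
proof -
  obtain K where K: "0 \<le> K" "\<And>x. norm (S x) \<le> K * norm x"
    using compact_op_bound[OF S] by blast
  obtain M where M: "0 \<le> M" "\<And>x. norm (T x) \<le> M * norm x"
    using compact_op_bound[OF T] by blast
  have "norm (S (T x) - T (S x)) \<le> (K * M + M * K) * norm x" for x
  proof -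
    have "norm (S (T x)) \<le> K * (M * norm x)"
      using K M by (meson mult_left_mono order_trans)
    moreover have "norm (T (S x)) \<le> M * (K * norm x)"
      using K M by (meson mult_left_mono order_trans)
    ultimately show ?thesis
      using norm_triangle_ineq4[of "S (T x)" "T (S x)"] by (simp add: algebra_simps)
  qed
  moreover have "clinear_op (\<lambda>x. S (T x) - T (S x))"
    using S T by (intro clinear_opI)
      (simp_all add: compact_op_def clinear_op_add clinear_op_scaleC scaleC_diff_right)
  ultimately show ?thesis
    unfolding bounded_op_def by blast
qed

text \<open>
  A set that lies within every \<open>r > 0\<close> of some compact set is totally bounded, because a finite
  net of the compact set is a slightly coarser net of the given one. This is what makes a
  norm limit of finite rank operators compact.
\<close>
lemma compact_closure_of_approx:
  fixes S :: "'a::complete_space set"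
  assumes approx: "\<And>r. r > 0 \<Longrightarrow> \<exists>K. compact K \<and> (\<forall>x\<in>S. \<exists>y\<in>K. dist x y < r)"
  shows "compact (closure S)"
  unfolding compact_eq_totally_bounded
proof (intro conjI allI impI)
  show "complete (closure S)"
    by (simp add: complete_eq_closed)
  fix r :: real
  assume r: "0 < r"
  obtain K where K: "compact K" "\<And>x. x \<in> S \<Longrightarrow> \<exists>y\<in>K. dist x y < r / 3"
    using approx[of "r / 3"] r by auto
  obtain k where k: "finite k" "K \<subseteq> (\<Union>x\<in>k. ball x (r / 3))"
    using K(1) r unfolding compact_eq_totally_bounded by (meson divide_pos_pos zero_less_numeral)
  have "x \<in> (\<Union>x\<in>k. ball x r)" if x: "x \<in> closure S" for x
  proof -
    obtain s where s: "s \<in> S" "dist s x < r / 3"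
      using x r unfolding closure_approachable by (meson divide_pos_pos zero_less_numeral)
    obtain y where y: "y \<in> K" "dist s y < r / 3"
      using K(2) s(1) by blast
    obtain z where z: "z \<in> k" "dist z y < r / 3"
      using k(2) y(1) by auto
    have "dist z x < r"
      using s(2) y(2) z(2) dist_triangle[of z x y] dist_triangle[of y x s]
      by (simp add: dist_commute)
    then show ?thesis
      using z(1) by auto
  qed
  then show "\<exists>k. finite k \<and> closure S \<subseteq> (\<Union>x\<in>k. ball x r)"
    using k(1) by blast
qed

text \<open>
  The finite rank part of the approximation: combinations of finitely many fixed vectors with bounded
  coefficients lie in a sum of compact discs.
\<close>
lemma compact_coefficient_sums:
  fixes v :: "nat \<Rightarrow> 'a::complex_hilbert"
  shows "\<exists>K. compact K \<and> (\<forall>c. (\<forall>i<n. cmod (c i) \<le> b) \<longrightarrow> (\<Sum>i<n. c i *\<^sub>C v i) \<in> K)"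
proof (induction n)
  case 0
  show ?case by (intro exI[of _ "{0}"]) auto
next
  case (Suc n)
  then obtain K where K: "compact K" "\<And>c. \<forall>i<n. cmod (c i) \<le> b \<Longrightarrow> (\<Sum>i<n. c i *\<^sub>C v i) \<in> K"
    by blast
  have "compact ((\<lambda>c. c *\<^sub>C v n) ` cball 0 b)"
    by (intro compact_continuous_image bounded_linear.continuous_on[OF bounded_linear_scaleC_left])
      (auto intro: continuous_on_id)
  then have "compact {x + y |x y. x \<in> K \<and> y \<in> (\<lambda>c. c *\<^sub>C v n) ` cball 0 b}"
    using K(1) by (rule compact_sums[rotated])
  moreover have "(\<Sum>i<Suc n. c i *\<^sub>C v i) \<in> {x + y |x y. x \<in> K \<and> y \<in> (\<lambda>c. c *\<^sub>C v n) ` cball 0 b}"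
    if c: "\<forall>i<Suc n. cmod (c i) \<le> b" for c
  proof -
    have "(\<Sum>i<n. c i *\<^sub>C v i) \<in> K" using K(2) c by simp
    moreover have "c n *\<^sub>C v n \<in> (\<lambda>c. c *\<^sub>C v n) ` cball 0 b" using c by simp
    ultimately show ?thesis by (simp only: sum.lessThan_Suc) blast
  qed
  ultimately show ?case by blast
qed

text \<open>
  For orthonormal families \<open>u\<close> and \<open>v\<close> this is the operator with singular values \<open>\<bar>w i\<bar>\<close>; its
  adjoint is obtained by exchanging \<open>u\<close> and \<open>v\<close>. With families that may span proper subspaces, both a
  weighted shift and its adjoint are of this form.
\<close>
definition weighted_op ::
    "(nat \<Rightarrow> real) \<Rightarrow> (nat \<Rightarrow> 'a::complex_hilbert) \<Rightarrow> (nat \<Rightarrow> 'a) \<Rightarrow> 'a \<Rightarrow> 'a" where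
  "weighted_op w u v x = (\<Sum>i. (complex_of_real (w i) * cinner (u i) x) *\<^sub>C v i)"

text \<open>
  The norm of a piece of the series is governed by the largest weight in that piece, uniformly in
  \<open>x\<close>. For weights tending to 0 this gives both convergence of the series and uniform
  approximation on the unit ball by its partial sums.
\<close>
lemma norm_weighted_sum_le:
  assumes u: "orthonormal u" and v: "orthonormal v" and F: "finite F"
    and w: "\<And>i. i \<in> F \<Longrightarrow> \<bar>w i\<bar> \<le> b" and b: "0 \<le> b"
  shows "norm (\<Sum>i\<in>F. (complex_of_real (w i) * cinner (u i) x) *\<^sub>C v i) \<le> b * norm x"
proof (rule power2_le_imp_le)
  have "(norm (\<Sum>i\<in>F. (complex_of_real (w i) * cinner (u i) x) *\<^sub>C v i))\<^sup>2
      = (\<Sum>i\<in>F. \<bar>w i\<bar>\<^sup>2 * (cmod (cinner (u i) x))\<^sup>2)"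
    by (simp add: norm_sum_orthonormal[OF v F] norm_mult power_mult_distrib)
  also have "\<dots> \<le> (\<Sum>i\<in>F. b\<^sup>2 * (cmod (cinner (u i) x))\<^sup>2)"
    by (intro sum_mono mult_right_mono power_mono w) auto
  also have "\<dots> \<le> b\<^sup>2 * (norm x)\<^sup>2"
    unfolding sum_distrib_left[symmetric]
    by (intro mult_left_mono Bessel_inequality[OF u F]) auto
  finally show "(norm (\<Sum>i\<in>F. (complex_of_real (w i) * cinner (u i) x) *\<^sub>C v i))\<^sup>2 \<le> (b * norm x)\<^sup>2"
    by (simp add: power_mult_distrib)
qed (use b in simp)

lemma null_sequence_tail_le:
  fixes w :: "nat \<Rightarrow> real"
  assumes "w \<longlonglongrightarrow> 0" and "0 < r"
  obtains N where "\<And>i. N \<le> i \<Longrightarrow> \<bar>w i\<bar> \<le> r"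
  using LIMSEQ_D[OF assms] by (metis diff_zero less_imp_le real_norm_def)

lemma summable_weighted_op:
  assumes u: "orthonormal u" and v: "orthonormal v" and w: "w \<longlonglongrightarrow> 0"
  shows "summable (\<lambda>i. (complex_of_real (w i) * cinner (u i) x) *\<^sub>C v i)"
  unfolding summable_Cauchy
proof (intro allI impI)
  fix r :: real
  assume r: "0 < r"
  define b where "b = r / (norm x + 1)"
  have b: "0 < b" "b * norm x < r"
    using r by (auto simp: b_def field_simps add_pos_nonneg add_nonneg_pos)
  obtain N where N: "\<And>i. N \<le> i \<Longrightarrow> \<bar>w i\<bar> \<le> b"
    using null_sequence_tail_le[OF w b(1)] by blast
  have "norm (\<Sum>i = m..<n. (complex_of_real (w i) * cinner (u i) x) *\<^sub>C v i) < r" if "N \<le> m" for m n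
    by (rule order_le_less_trans[OF norm_weighted_sum_le[OF u v _ _ less_imp_le[OF b(1)]] b(2)])
      (use that N in auto)
  then show "\<exists>N. \<forall>m\<ge>N. \<forall>n. norm (\<Sum>i = m..<n. (complex_of_real (w i) * cinner (u i) x) *\<^sub>C v i) < r"
    by blast
qed

lemma compact_op_weighted_op:
  assumes u: "orthonormal u" and v: "orthonormal v" and w: "w \<longlonglongrightarrow> 0"
  shows "compact_op (weighted_op w u v)"
  unfolding compact_op_def
proof
  note summ = summable_weighted_op[OF u v w]
  show "clinear_op (weighted_op w u v)"
  proof (rule clinear_opI)
    fix x y and c :: complex
    show "weighted_op w u v (x + y) = weighted_op w u v x + weighted_op w u v y"
      unfolding weighted_op_def suminf_add[OF summ summ]
      by (simp add: cinner_add_right distrib_left scaleC_add_left)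
    show "weighted_op w u v (c *\<^sub>C x) = c *\<^sub>C weighted_op w u v x"
      unfolding weighted_op_def bounded_linear.suminf[OF bounded_linear_scaleC summ]
      by (simp add: cinner_scaleC_right scaleC_scaleC mult.left_commute)
  qed
  show "compact (closure (weighted_op w u v ` cball 0 1))"
  proof (rule compact_closure_of_approx)
    fix r :: real
    assume r: "0 < r"
    let ?f = "\<lambda>x i. (complex_of_real (w i) * cinner (u i) x) *\<^sub>C v i"
    obtain N where N: "\<And>i. N \<le> i \<Longrightarrow> \<bar>w i\<bar> \<le> r / 2"
      using null_sequence_tail_le[OF w, of "r / 2"] r by auto
    obtain b where b: "0 < b" "\<And>i. \<bar>w i\<bar> \<le> b"
      using w convergent_imp_Bseq[of w] unfolding Bseq_def convergent_def by auto
    obtain K where K: "compact K" "\<And>c. \<forall>i<N. cmod (c i) \<le> b \<Longrightarrow> (\<Sum>i<N. c i *\<^sub>C v i) \<in> K"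
      using compact_coefficient_sums[of N b v] by blast
    \<comment> \<open>The first \<open>N\<close> terms stay in the compact set \<open>K\<close>; the remaining ones add at most \<open>r / 2\<close>.\<close>
    have "\<exists>y\<in>K. dist (weighted_op w u v x) y < r" if x: "norm x \<le> 1" for x
    proof
      have "cmod (complex_of_real (w i) * cinner (u i) x) \<le> b" for i
      proof -
        have "(cmod (cinner (u i) x))\<^sup>2 \<le> (norm x)\<^sup>2"
          using Bessel_inequality[OF u, of "{i}" x] by simp
        then have "cmod (cinner (u i) x) \<le> 1"
          using x power2_le_imp_le[of "cmod (cinner (u i) x)" "norm x"] by simp
        then show ?thesis
          using b mult_mono[of "\<bar>w i\<bar>" b "cmod (cinner (u i) x)" 1] by (simp add: norm_mult)
      qed
      then show "(\<Sum>i<N. ?f x i) \<in> K"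
        by (intro K(2)) auto
      have lim: "(\<lambda>n. (\<Sum>i<n. ?f x i) - (\<Sum>i<N. ?f x i)) \<longlonglongrightarrow> weighted_op w u v x - (\<Sum>i<N. ?f x i)"
        unfolding weighted_op_def by (intro tendsto_diff summable_LIMSEQ summ tendsto_const)
      have tail: "\<forall>\<^sub>F n in sequentially. norm ((\<Sum>i<n. ?f x i) - (\<Sum>i<N. ?f x i)) \<le> r / 2"
      proof (rule eventually_sequentiallyI)
        fix n
        assume "N \<le> n"
        then have "(\<Sum>i<n. ?f x i) - (\<Sum>i<N. ?f x i) = (\<Sum>i=N..<n. ?f x i)"
          using sum_diff_nat_ivl[of 0 N n "?f x"] by (simp add: atLeast0LessThan)
        also have "norm \<dots> \<le> r / 2 * norm x"
          by (rule norm_weighted_sum_le[OF u v]) (use N r in auto)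
        also have "\<dots> \<le> r / 2 * 1"
          using x r by (intro mult_left_mono) auto
        finally show "norm ((\<Sum>i<n. ?f x i) - (\<Sum>i<N. ?f x i)) \<le> r / 2" by simp
      qed
      have "norm (weighted_op w u v x - (\<Sum>i<N. ?f x i)) \<le> r / 2"
        by (rule Lim_norm_ubound[OF _ lim tail]) simp
      then show "dist (weighted_op w u v x) (\<Sum>i<N. ?f x i) < r"
        using r by (simp add: dist_norm)
    qed
    then show "\<exists>K. compact K \<and> (\<forall>x\<in>weighted_op w u v ` cball 0 1. \<exists>y\<in>K. dist x y < r)"
      using K(1) by auto
  qed
qed

lemma scaleC_zero_left: "0 *\<^sub>C (x :: 'a::complex_hilbert) = 0"
  using scaleC_add_left[of 0 0 x] by simp

lemma weighted_op_basis:
  assumes "orthonormal u"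
  shows "weighted_op w u v (u i) = w i *\<^sub>R v i"
proof -
  have "(complex_of_real (w j) * cinner (u j) (u i)) *\<^sub>C v j = (if j = i then w i *\<^sub>R v i else 0)" for j
    using assms by (auto simp: orthonormal_def scaleR_eq_scaleC scaleC_zero_left)
  then show ?thesis
    unfolding weighted_op_def using suminf_finite[of "{i}" "\<lambda>j. if j = i then w i *\<^sub>R v i else 0"] by simp
qed

lemma weighted_op_orthogonal:
  assumes "\<And>i. cinner (u i) x = 0"
  shows "weighted_op w u v x = 0"
  by (simp add: weighted_op_def assms scaleC_zero_left)

section \<open>Weighted shifts along a map of block places\<close>

definition place :: "nat \<Rightarrow> nat \<times> nat" where
  "place = inv_into block_places (\<lambda>(k, n). block_index k n)"

lemma bij_betw_place: "bij_betw place UNIV block_places"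
  unfolding place_def by (rule bij_betw_inv_into[OF bij_betw_block_index])

lemma block_index_place: "(\<lambda>(k, n). block_index k n) (place i) = i"
  unfolding place_def using bij_betw_block_index by (intro f_inv_into_f) (simp add: bij_betw_def)

lemma place_surj:
  assumes "P \<in> block_places"
  obtains i where "place i = P"
  using assms bij_betw_imp_surj_on[OF bij_betw_place] by (metis imageE)

text \<open>
  Each block is finite, so a bound that depends on the block only and tends to 0 leaves only finitely
  many places with weight at least \<open>r\<close>.
\<close>
lemma place_weights_tendsto_zero:
  assumes w: "\<And>k n. (k, n) \<in> block_places \<Longrightarrow> \<bar>w (k, n)\<bar> \<le> c n" and c: "c \<longlonglongrightarrow> (0::real)"
  shows "(\<lambda>i. w (place i)) \<longlonglongrightarrow> 0"
proof (rule LIMSEQ_I)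
  fix r :: real
  assume "0 < r"
  then obtain N where N: "\<And>n. N \<le> n \<Longrightarrow> \<bar>c n\<bar> < r"
    using LIMSEQ_D[OF c] by (metis diff_zero real_norm_def)
  have "{i. r \<le> \<bar>w (place i)\<bar>} \<subseteq> (\<lambda>(k, n). block_index k n) ` ({..N} \<times> {..N})"
  proof
    fix i
    assume i: "i \<in> {i. r \<le> \<bar>w (place i)\<bar>}"
    obtain k n where kn: "place i = (k, n)" by fastforce
    have p: "(k, n) \<in> block_places"
      using bij_betwE[OF bij_betw_place] kn by (metis UNIV_I)
    then have "n < N"
      using i w[OF p] N[of n] kn by (force simp: not_less[symmetric])
    then show "i \<in> (\<lambda>(k, n). block_index k n) ` ({..N} \<times> {..N})"
      using p kn block_index_place[of i] by (intro image_eqI[of _ _ "(k, n)"]) (auto simp: block_places_def)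
  qed
  then have "finite {i. r \<le> \<bar>w (place i)\<bar>}"
    by (rule finite_subset) simp
  then obtain M where "\<And>i. i \<in> {i. r \<le> \<bar>w (place i)\<bar>} \<Longrightarrow> i < M"
    using finite_nat_set_iff_bounded by meson
  then show "\<exists>M. \<forall>i\<ge>M. norm (w (place i) - 0) < r"
    by (intro exI[of _ M]) (force simp: not_le[symmetric])
qed

text \<open>
  \<open>S\<close> is the weighted shift that moves the place \<open>P\<close> to \<open>\<sigma> P\<close>, and \<open>S'\<close> is its adjoint. The places
  outside the range of \<open>\<sigma>\<close> are orthogonal to the range of \<open>S\<close>, hence killed by \<open>S'\<close>.
\<close>
lemma compact_block_shift:
  fixes e :: "nat \<Rightarrow> 'a::complex_hilbert"
  defines "f \<equiv> \<lambda>(k, n). e (block_index k n)"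
  assumes e: "orthonormal e"
    and \<sigma>: "inj_on \<sigma> block_places" "\<sigma> ` block_places \<subseteq> block_places"
    and w: "\<And>k n. (k, n) \<in> block_places \<Longrightarrow> \<bar>w (k, n)\<bar> \<le> c n" "c \<longlonglongrightarrow> (0::real)"
  obtains S S' where "compact_op S" "compact_op S'"
    "\<And>P. P \<in> block_places \<Longrightarrow> S (f P) = w P *\<^sub>R f (\<sigma> P)"
    "\<And>P. P \<in> block_places \<Longrightarrow> S' (f (\<sigma> P)) = w P *\<^sub>R f P"
    "\<And>Q. Q \<in> block_places - \<sigma> ` block_places \<Longrightarrow> S' (f Q) = 0"
proof -
  define g where "g i = (\<lambda>(k, n). block_index k n) (\<sigma> (place i))" for i
  have fe: "f (place i) = e i" for i
    using block_index_place[of i] by (simp add: f_def split: prod.splits)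
  have fg: "f (\<sigma> (place i)) = e (g i)" for i
    by (simp add: f_def g_def split: prod.splits)
  have place_in: "place i \<in> block_places" for i
    using bij_betwE[OF bij_betw_place] by blast
  have place_g: "place (g i) = \<sigma> (place i)" for i
  proof -
    have "\<sigma> (place i) \<in> block_places"
      using \<sigma>(2) place_in by blast
    then show ?thesis
      unfolding g_def place_def by (rule bij_betw_inv_into_left[OF bij_betw_block_index])
  qed
  have "inj g"
  proof (rule injI)
    fix i j
    assume "g i = g j"
    then have "\<sigma> (place i) = \<sigma> (place j)"
      by (metis place_g)
    then have "place i = place j"
      using inj_onD[OF \<sigma>(1)] place_in by blast
    then show "i = j"
      using bij_betw_imp_inj_on[OF bij_betw_place] by (simp add: inj_eq)
  qed
  then have eg: "orthonormal (\<lambda>i. e (g i))"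
    by (rule orthonormal_compose[OF e])
  let ?w = "\<lambda>i. w (place i)"
  have lim: "?w \<longlonglongrightarrow> 0"
    by (rule place_weights_tendsto_zero[OF w])
  let ?S = "weighted_op ?w e (\<lambda>i. e (g i))" and ?S' = "weighted_op ?w (\<lambda>i. e (g i)) e"
  have S': "?S' (e (g i)) = ?w i *\<^sub>R e i" for i
    using weighted_op_basis[OF eg] by blast
  show thesis
  proof (rule that[of ?S ?S'])
    show "compact_op ?S" "compact_op ?S'"
      by (rule compact_op_weighted_op[OF e eg lim] compact_op_weighted_op[OF eg e lim])+
    show "?S (f P) = w P *\<^sub>R f (\<sigma> P)" "?S' (f (\<sigma> P)) = w P *\<^sub>R f P" if P: "P \<in> block_places" for P
      using place_surj[OF P] weighted_op_basis[OF e, of ?w "\<lambda>i. e (g i)"] S' by (metis fe fg)+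
    show "?S' (f Q) = 0" if Q: "Q \<in> block_places - \<sigma> ` block_places" for Q
    proof -
      obtain j where j: "place j = Q"
        using Q place_surj by blast
      have "g i \<noteq> j" for i
      proof
        assume "g i = j"
        then have "\<sigma> (place i) = Q"
          using place_g[of i] j by simp
        then show False
          using Q place_in[of i] by blast
      qed
      then have "cinner (e (g i)) (f Q) = 0" for i
        using e j fe[of j] by (metis orthonormal_def)
      then show ?thesis
        by (rule weighted_op_orthogonal)
    qed
  qed
qed

section \<open>The diagonal operator as a commutator\<close>

text \<open>
  The weights are the solution of two systems: the edges leaving the place \<open>(k, n)\<close> must carry
  \<open>(d\<^bsub>n\<^esub> / n) (1 + \<epsilon>\<^bsub>k\<^esub> / (n + 1))\<close> together, and those entering \<open>(k, n + 1)\<close> must carry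
  \<open>(d\<^bsub>n\<^esub> / (n + 1)) (1 + \<epsilon>\<^bsub>k-1\<^esub> / n)\<close> together; starting at \<open>k = 1\<close>, where only a vertical edge
  enters, these determine the weights one after another. The edges that would come from outside the
  array get weight 0: the vertical weight vanishes for \<open>k = n + 1\<close>, the diagonal one for \<open>k = 0\<close>
  because \<open>\<epsilon>\<^bsub>0\<^esub> = 0\<close>, and both for \<open>n = 0\<close> because division by 0 yields 0.
\<close>
definition vertical_weight :: "(nat \<Rightarrow> real) \<Rightarrow> nat \<Rightarrow> nat \<Rightarrow> real" where
  "vertical_weight d k n = d n * (real n + 1 - real k) / (real n * (real n + 1))"

definition diagonal_weight :: "(nat \<Rightarrow> real) \<Rightarrow> (nat \<Rightarrow> real) \<Rightarrow> nat \<Rightarrow> nat \<Rightarrow> real" where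
  "diagonal_weight \<epsilon> d k n = d n * (real k + \<epsilon> k) / (real n * (real n + 1))"

lemma weights_commute:
  "vertical_weight d k n * diagonal_weight \<epsilon> d k (n + 1)
    = diagonal_weight \<epsilon> d k n * vertical_weight d (k + 1) (n + 1)"
  by (simp add: vertical_weight_def diagonal_weight_def mult_ac)

text \<open>
  This balance of outgoing and incoming edges is what the weights were chosen for; it is the diagonal
  of \<open>(U\<^sup>* U - U U\<^sup>*) + (V\<^sup>* V - V V\<^sup>*)\<close>.
\<close>
lemma entry_eq_weights:
  assumes "\<epsilon> 0 = 0" and "(k, n) \<in> block_places"
  shows "entry \<epsilon> d k n = vertical_weight d k n + diagonal_weight \<epsilon> d k n
    - vertical_weight d k (n - 1) - diagonal_weight \<epsilon> d (k - 1) (n - 1)"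
proof (cases "n = 1")
  case True
  then have "k = 1"
    using assms(2) by (simp add: block_places_def)
  then show ?thesis
    using True assms(1) by (simp add: entry_def vertical_weight_def diagonal_weight_def field_simps)
next
  case False
  then obtain m where m: "n = m + 1" "m \<ge> 1"
    using assms(2) by (cases n) (auto simp: block_places_def)
  obtain j where j: "k = j + 1"
    using assms(2) by (cases k) (auto simp: block_places_def)
  have "real m > 0" using m by simp
  then show ?thesis
    using m unfolding j
    by (simp add: entry_def vertical_weight_def diagonal_weight_def divide_simps) (simp add: algebra_simps)
qed

lemma admissible_eps_less_1:
  assumes "admissible \<epsilon> \<alpha> d" and "n \<ge> 1"
  shows "\<epsilon> n < 1"
proof -
  have "\<epsilon> n \<le> (SUP n\<in>{1..}. \<epsilon> n)"
    using assms by (intro cSUP_upper) (auto simp: admissible_def)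
  then show ?thesis
    using assms by (simp add: admissible_def)
qed

text \<open>
  Beyond the first block, with \<open>n = m + 1\<close>, the entry is
  \<open>(d\<^bsub>m+1\<^esub> (1 + \<epsilon>\<^bsub>k\<^esub> / (m + 2)) - d\<^bsub>m\<^esub> (1 + \<epsilon>\<^bsub>k-1\<^esub> / m)) / (m + 1)\<close>, and the strict lower bound
  required of \<open>d\<^bsub>m+1\<^esub>\<close> says exactly that the numerator is positive.
\<close>
lemma entry_pos:
  assumes adm: "admissible \<epsilon> \<alpha> d" and "(k, n) \<in> block_places"
  shows "0 < entry \<epsilon> d k n"
proof (cases "n = 1")
  case True
  then show ?thesis
    using adm by (simp add: entry_def admissible_def add_pos_pos)
next
  case False
  then obtain m where m: "n = m + 1" "m \<ge> 1"
    using assms(2) by (cases n) (auto simp: block_places_def)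
  have k: "k \<in> {1..m + 1}"
    using assms(2) m by (simp add: block_places_def)
  have "0 < \<epsilon> k"
    using adm k by (simp add: admissible_def)
  then have pos: "0 < 1 + \<epsilon> k / real (m + 2)"
    by (simp add: add_pos_pos)
  have "d m * ((1 + \<epsilon> (k - 1) / real m) / (1 + \<epsilon> k / real (m + 2))) < d (m + 1)"
    using adm m k by (simp add: admissible_def)
  then have "d m * (1 + \<epsilon> (k - 1) / real m) < d (m + 1) * (1 + \<epsilon> k / real (m + 2))"
    using pos by (simp add: divide_simps split: if_splits)
  then have "0 < (d (m + 1) * (1 + \<epsilon> k / real (m + 2)) - d m * (1 + \<epsilon> (k - 1) / real m)) / real (m + 1)"
    by simp
  also have "\<dots> = entry \<epsilon> d k n"
    using m by (simp add: entry_def divide_simps) (simp add: algebra_simps)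
  finally show ?thesis .
qed

text \<open>
  The computation of \<open>C Z - Z C\<close> for \<open>C = U + V'\<close> and \<open>Z = V - U'\<close>, where \<open>U'\<close> and \<open>V'\<close> act on
  the basis as the adjoints of \<open>U\<close> and \<open>V\<close>. The vector two blocks up occurs twice, with the two products of
  weights around a square, and cancels by \<open>comm\<close>; so does the vector two blocks down. At the rim of
  the array a basis vector named in the calculation may lie outside it (such as \<open>F (k - 1) (n - 1)\<close>
  for \<open>k = 1\<close>), but then its coefficient is one of the vanishing weights.
\<close>
lemma commutator_on_basis:
  fixes F :: "nat \<Rightarrow> nat \<Rightarrow> 'a::real_vector"
  assumes lin: "linear U" "linear U'" "linear V" "linear V'"
    and U: "\<And>k n. (k, n) \<in> block_places \<Longrightarrow> U (F k n) = sqrt (p k n) *\<^sub>R F k (n + 1)"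
    and U': "\<And>k n. (k, n) \<in> block_places \<Longrightarrow> U' (F k n) = sqrt (p k (n - 1)) *\<^sub>R F k (n - 1)"
    and V: "\<And>k n. (k, n) \<in> block_places \<Longrightarrow> V (F k n) = sqrt (q k n) *\<^sub>R F (k + 1) (n + 1)"
    and V': "\<And>k n. (k, n) \<in> block_places \<Longrightarrow> V' (F k n) = sqrt (q (k - 1) (n - 1)) *\<^sub>R F (k - 1) (n - 1)"
    and comm: "\<And>k n. p k n * q k (n + 1) = q k n * p (k + 1) (n + 1)"
    and p0: "\<And>n. p (n + 1) n = 0" and q0: "\<And>n. q 0 n = 0" and p00: "\<And>k. p k 0 = 0"
    and pos: "\<And>k n. k \<le> n + 1 \<Longrightarrow> 0 \<le> p k n" "\<And>k n. 0 \<le> q k n"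
    and kn: "(k, n) \<in> block_places"
  shows "(\<lambda>x. U x + V' x) (V (F k n) - U' (F k n)) - (\<lambda>x. V x - U' x) (U (F k n) + V' (F k n))
    = (p k n + q k n - p k (n - 1) - q (k - 1) (n - 1)) *\<^sub>R F k n"
proof -
  interpret U: linear U by (rule lin)
  interpret U': linear U' by (rule lin)
  interpret V: linear V by (rule lin)
  interpret V': linear V' by (rule lin)
  note lins = U.add U'.add V.add V'.add U.diff U'.diff V.diff V'.diff U.scale U'.scale V.scale V'.scale
  have sq: "sqrt (p k n) * sqrt (p k n) = p k n" "sqrt (q k n) * sqrt (q k n) = q k n"
    "sqrt (p k (n - 1)) * sqrt (p k (n - 1)) = p k (n - 1)"
    "sqrt (q (k - 1) (n - 1)) * sqrt (q (k - 1) (n - 1)) = q (k - 1) (n - 1)"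
    using pos kn by (simp_all add: block_places_def)
  have up: "sqrt (p k n) * sqrt (q k (n + 1)) = sqrt (q k n) * sqrt (p (k + 1) (n + 1))"
    by (simp only: real_sqrt_mult[symmetric] comm)
  have down: "sqrt (p k (n - 1)) * sqrt (q (k - 1) (n - 1 - 1))
    = sqrt (q (k - 1) (n - 1)) * sqrt (p (k - 1) (n - 1 - 1))"
  proof -
    consider "k = 1" | "k = 2" "n = 2" | "k \<ge> 2" "n \<ge> 3"
      using kn by (fastforce simp: block_places_def)
    then show ?thesis
    proof cases
      case 2
      then show ?thesis using p0[of 1] p00 by (simp add: numeral_2_eq_2)
    next
      case 3
      then have k: "k - 1 + 1 = k" and n: "n - 1 - 1 + 1 = n - 1" by auto
      have "p k (n - 1) * q (k - 1) (n - 1 - 1) = q (k - 1) (n - 1) * p (k - 1) (n - 1 - 1)"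
        using comm[of "k - 1" "n - 1 - 1"] unfolding k n by (simp only: mult.commute)
      then show ?thesis
        by (simp only: real_sqrt_mult[symmetric])
    qed (use q0 in simp)
  qed
  \<comment> \<open>For \<open>k = n\<close> there is no place \<open>(k, n - 1)\<close>, but the factor \<open>p k (n - 1)\<close> is 0.\<close>
  have left: "sqrt (p k (n - 1)) *\<^sub>R (U (F k (n - 1)) + V' (F k (n - 1)))
    = sqrt (p k (n - 1)) *\<^sub>R (sqrt (p k (n - 1)) *\<^sub>R F k n
        + sqrt (q (k - 1) (n - 1 - 1)) *\<^sub>R F (k - 1) (n - 1 - 1))"
  proof (cases "k = n")
    case True
    then show ?thesis using p0[of "n - 1"] kn by (simp add: block_places_def)
  next
    case False
    then have "(k, n - 1) \<in> block_places" "n - 1 + 1 = n"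
      using kn by (auto simp: block_places_def)
    then show ?thesis using U[of k "n - 1"] V'[of k "n - 1"] by simp
  qed
  \<comment> \<open>For \<open>k = 1\<close> there is no place \<open>(k - 1, n - 1)\<close>, but the factor \<open>q (k - 1) (n - 1)\<close> is 0.\<close>
  have right: "sqrt (q (k - 1) (n - 1)) *\<^sub>R (V (F (k - 1) (n - 1)) - U' (F (k - 1) (n - 1)))
    = sqrt (q (k - 1) (n - 1)) *\<^sub>R (sqrt (q (k - 1) (n - 1)) *\<^sub>R F k n
        - sqrt (p (k - 1) (n - 1 - 1)) *\<^sub>R F (k - 1) (n - 1 - 1))"
  proof (cases "k = 1")
    case True
    then show ?thesis using q0 by simp
  next
    case False
    then have "(k - 1, n - 1) \<in> block_places" "n - 1 + 1 = n" "k - 1 + 1 = k"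
      using kn by (auto simp: block_places_def)
    then show ?thesis using V[of "k - 1" "n - 1"] U'[of "k - 1" "n - 1"] by simp
  qed
  have places: "(k + 1, n + 1) \<in> block_places" "(k, n + 1) \<in> block_places"
    using kn by (auto simp: block_places_def)
  have C: "(\<lambda>x. U x + V' x) (V (F k n) - U' (F k n))
    = sqrt (q k n) *\<^sub>R (U (F (k + 1) (n + 1)) + V' (F (k + 1) (n + 1)))
      - sqrt (p k (n - 1)) *\<^sub>R (U (F k (n - 1)) + V' (F k (n - 1)))"
    unfolding V[OF kn] U'[OF kn] lins by (simp add: algebra_simps)
  have Z: "(\<lambda>x. V x - U' x) (U (F k n) + V' (F k n))
    = sqrt (p k n) *\<^sub>R (V (F k (n + 1)) - U' (F k (n + 1)))
      + sqrt (q (k - 1) (n - 1)) *\<^sub>R (V (F (k - 1) (n - 1)) - U' (F (k - 1) (n - 1)))"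
    unfolding U[OF kn] V'[OF kn] lins by (simp add: algebra_simps)
  have Cup: "U (F (k + 1) (n + 1)) + V' (F (k + 1) (n + 1))
    = sqrt (p (k + 1) (n + 1)) *\<^sub>R F (k + 1) (n + 2) + sqrt (q k n) *\<^sub>R F k n"
    using U[OF places(1)] V'[OF places(1)] by simp
  have Zup: "V (F k (n + 1)) - U' (F k (n + 1))
    = sqrt (q k (n + 1)) *\<^sub>R F (k + 1) (n + 2) - sqrt (p k n) *\<^sub>R F k n"
    using V[OF places(2)] U'[OF places(2)] by simp
  show ?thesis
    unfolding C Z left right Cup Zup
    unfolding scaleR_right_distrib scaleR_right_diff_distrib scaleR_scaleR sq up down
    by (simp add: scaleR_left_distrib scaleR_left_diff_distrib)
qed

text \<open>
  The operator \<open>D\<close> is obtained as the commutator itself: that \<open>D\<close> is bounded comes for free, and its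
  action on the basis identifies it as the block diagonal operator.
\<close>
lemma block_diagonal_commutator:
  fixes e :: "nat \<Rightarrow> 'a::complex_hilbert"
  assumes e: "orthonormal_basis e" and adm: "admissible \<epsilon> \<alpha> d"
  shows "\<exists>D. block_diagonal_op e (entry \<epsilon> d) D \<and> commutator_of_compacts D"
proof -
  define p where "p = vertical_weight d"
  define q where "q = diagonal_weight \<epsilon> d"
  define F where "F k n = e (block_index k n)" for k n
  have on: "orthonormal e"
    using e by (simp add: orthonormal_basis_def orthonormal_def)
  have eps0: "\<epsilon> 0 = 0" and dpos: "\<And>n. n \<ge> 1 \<Longrightarrow> 0 \<le> d n" and lim: "(\<lambda>n. \<alpha> n / real n) \<longlonglongrightarrow> 0"
    and d1: "d 1 \<le> \<alpha> 1"
    using adm by (simp_all add: admissible_def less_imp_le)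
  have dS: "d (n + 1) \<le> \<alpha> (n + 1)" if "n \<ge> 1" for n
  proof -
    have "1 \<in> {1..n + 1}" by simp
    then show ?thesis using adm that unfolding admissible_def by blast
  qed
  have eps: "0 \<le> \<epsilon> n \<and> \<epsilon> n \<le> 1" for n
  proof (cases "n = 0")
    case False
    then show ?thesis
      using adm admissible_eps_less_1[OF adm, of n] by (simp add: admissible_def less_imp_le)
  qed (simp add: eps0)
  have d\<alpha>: "d n \<le> \<alpha> n" if "n \<ge> 1" for n
  proof (cases "n = 1")
    case False
    then show ?thesis using that dS[of "n - 1"] by simp
  qed (use d1 in simp)
  have p_pos: "0 \<le> p k n" if "k \<le> n + 1" for k n
    using dpos[of n] that by (cases "n = 0") (auto simp: p_def vertical_weight_def)
  have q_pos: "0 \<le> q k n" for k n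
    using dpos[of n] eps[of k] by (cases "n = 0") (auto simp: q_def diagonal_weight_def)
  \<comment> \<open>Both numerators are at most \<open>n + 1\<close>; for the diagonal edges this uses \<open>k \<le> n\<close> and \<open>\<epsilon> k \<le> 1\<close>.\<close>
  have p_le: "p k n \<le> \<alpha> n / real n" and q_le: "q k n \<le> \<alpha> n / real n"
    if kn: "(k, n) \<in> block_places" for k n
  proof -
    have n: "n \<ge> 1" and kn': "1 \<le> k" "k \<le> n" using kn by (auto simp: block_places_def)
    have step: "d n * a / (real n * (real n + 1)) \<le> \<alpha> n / real n" if "a \<le> real n + 1" for a
    proof -
      have "d n * a / (real n * (real n + 1)) \<le> d n * (real n + 1) / (real n * (real n + 1))"
        using that dpos[OF n] by (intro divide_right_mono mult_left_mono) auto
      also have "\<dots> = d n / real n"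
        by simp
      also have "\<dots> \<le> \<alpha> n / real n"
        using d\<alpha>[OF n] by (intro divide_right_mono) auto
      finally show ?thesis .
    qed
    show "p k n \<le> \<alpha> n / real n"
      unfolding p_def vertical_weight_def by (rule step) simp
    show "q k n \<le> \<alpha> n / real n"
      unfolding q_def diagonal_weight_def by (rule step) (use kn' eps[of k] in linarith)
  qed
  have lim': "(\<lambda>n. sqrt (\<alpha> n / real n)) \<longlonglongrightarrow> 0"
    using tendsto_real_sqrt[OF lim] by simp
  have bound_p: "\<bar>(\<lambda>(k, n). sqrt (p k n)) (k, n)\<bar> \<le> sqrt (\<alpha> n / real n)" if "(k, n) \<in> block_places" for k n
    using p_le[OF that] p_pos[of k n] that by (simp add: block_places_def)
  have inj_p: "inj_on (\<lambda>(k, n). (k, n + 1)) block_places"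
    and sub_p: "(\<lambda>(k, n). (k, n + 1)) ` block_places \<subseteq> block_places"
    by (auto simp: inj_on_def block_places_def)
  obtain U U' where UU: "compact_op U" "compact_op U'"
    and U: "\<And>P. P \<in> block_places \<Longrightarrow> U ((\<lambda>(k, n). e (block_index k n)) P)
        = (\<lambda>(k, n). sqrt (p k n)) P *\<^sub>R (\<lambda>(k, n). e (block_index k n)) ((\<lambda>(k, n). (k, n + 1)) P)"
    and U': "\<And>P. P \<in> block_places \<Longrightarrow> U' ((\<lambda>(k, n). e (block_index k n)) ((\<lambda>(k, n). (k, n + 1)) P))
        = (\<lambda>(k, n). sqrt (p k n)) P *\<^sub>R (\<lambda>(k, n). e (block_index k n)) P"
    and U0: "\<And>P. P \<in> block_places - (\<lambda>(k, n). (k, n + 1)) ` block_places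
        \<Longrightarrow> U' ((\<lambda>(k, n). e (block_index k n)) P) = 0"
    by (rule compact_block_shift[where w = "\<lambda>(k, n). sqrt (p k n)" and c = "\<lambda>n. sqrt (\<alpha> n / real n)",
          OF on inj_p sub_p bound_p lim'], assumption) (rule that)
  have bound_q: "\<bar>(\<lambda>(k, n). sqrt (q k n)) (k, n)\<bar> \<le> sqrt (\<alpha> n / real n)" if "(k, n) \<in> block_places" for k n
    using q_le[OF that] q_pos[of k n] that by (simp add: block_places_def)
  have inj_q: "inj_on (\<lambda>(k, n). (k + 1, n + 1)) block_places"
    and sub_q: "(\<lambda>(k, n). (k + 1, n + 1)) ` block_places \<subseteq> block_places"
    by (auto simp: inj_on_def block_places_def)
  obtain V V' where VV: "compact_op V" "compact_op V'"
    and V: "\<And>P. P \<in> block_places \<Longrightarrow> V ((\<lambda>(k, n). e (block_index k n)) P)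
        = (\<lambda>(k, n). sqrt (q k n)) P *\<^sub>R (\<lambda>(k, n). e (block_index k n)) ((\<lambda>(k, n). (k + 1, n + 1)) P)"
    and V': "\<And>P. P \<in> block_places \<Longrightarrow> V' ((\<lambda>(k, n). e (block_index k n)) ((\<lambda>(k, n). (k + 1, n + 1)) P))
        = (\<lambda>(k, n). sqrt (q k n)) P *\<^sub>R (\<lambda>(k, n). e (block_index k n)) P"
    and V0: "\<And>P. P \<in> block_places - (\<lambda>(k, n). (k + 1, n + 1)) ` block_places
        \<Longrightarrow> V' ((\<lambda>(k, n). e (block_index k n)) P) = 0"
    by (rule compact_block_shift[where w = "\<lambda>(k, n). sqrt (q k n)" and c = "\<lambda>n. sqrt (\<alpha> n / real n)",
          OF on inj_q sub_q bound_q lim'], assumption) (rule that)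
  have p0: "p (n + 1) n = 0" and p00: "p k 0 = 0" and q0: "q 0 n = 0" for k n
    using eps0 by (simp_all add: p_def q_def vertical_weight_def diagonal_weight_def)
  have U'F: "U' (F k n) = sqrt (p k (n - 1)) *\<^sub>R F k (n - 1)" if kn: "(k, n) \<in> block_places" for k n
  proof (cases "k = n")
    case True
    then have "U' (F k n) = 0"
      using U0[of "(k, n)"] kn by (force simp: F_def block_places_def)
    then show ?thesis
      using True kn p0[of "n - 1"] by (simp add: block_places_def)
  next
    case False
    then have "(k, n - 1) \<in> block_places" "n - 1 + 1 = n"
      using kn by (auto simp: block_places_def)
    then show ?thesis
      using U'[of "(k, n - 1)"] by (simp add: F_def)
  qed
  have V'F: "V' (F k n) = sqrt (q (k - 1) (n - 1)) *\<^sub>R F (k - 1) (n - 1)"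
    if kn: "(k, n) \<in> block_places" for k n
  proof (cases "k = 1")
    case True
    then have "V' (F k n) = 0"
      using V0[of "(k, n)"] kn by (force simp: F_def block_places_def)
    then show ?thesis
      using True q0 by simp
  next
    case False
    then have "(k - 1, n - 1) \<in> block_places" "n - 1 + 1 = n" "k - 1 + 1 = k"
      using kn by (auto simp: block_places_def)
    then show ?thesis
      using V'[of "(k - 1, n - 1)"] by (simp add: F_def)
  qed
  define C where "C x = U x + V' x" for x
  define Z where "Z x = V x - U' x" for x
  have CZ: "compact_op C" "compact_op Z"
    unfolding C_def[abs_def] Z_def[abs_def] using UU VV by (auto intro: compact_op_plus compact_op_minus)
  have lin: "linear U" "linear U'" "linear V" "linear V'"
    using UU VV by (simp_all add: compact_op_def clinear_op_linear)
  have UF: "U (F k n) = sqrt (p k n) *\<^sub>R F k (n + 1)"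
    and VF: "V (F k n) = sqrt (q k n) *\<^sub>R F (k + 1) (n + 1)" if "(k, n) \<in> block_places" for k n
    using U[OF that] V[OF that] by (simp_all add: F_def)
  have comm: "p k n * q k (n + 1) = q k n * p (k + 1) (n + 1)" for k n
    unfolding p_def q_def by (rule weights_commute)
  have "C (Z (F k n)) - Z (C (F k n)) = entry \<epsilon> d k n *\<^sub>R F k n" if kn: "(k, n) \<in> block_places" for k n
    using commutator_on_basis[of U U' V V' F p q, OF lin UF U'F VF V'F comm p0 q0 p00 p_pos q_pos kn]
    unfolding C_def Z_def entry_eq_weights[where \<epsilon> = \<epsilon>, OF eps0 kn] p_def q_def by simp
  then have "block_diagonal_op e (entry \<epsilon> d) (\<lambda>x. C (Z x) - Z (C x))"
    using bounded_op_commutator[OF CZ] by (auto simp: block_diagonal_op_def F_def scaleR_eq_scaleC)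
  then show ?thesis
    using CZ unfolding commutator_of_compacts_def by blast
qed

section \<open>A family with distinct diagonal entries\<close>

definition geometric :: "nat \<Rightarrow> real" where
  "geometric k = (if k = 0 then 0 else 1 / 3 ^ k)"

definition root_seq :: "nat \<Rightarrow> real" where
  "root_seq n = sqrt (real n)"

text \<open>
  Here the supremum of the \<open>\<epsilon>\<^bsub>k\<^esub>\<close> is \<open>t / 3\<close>, attained at \<open>k = 1\<close>. Square roots grow fast enough because
  \<open>(1 + (t / 3) / n)\<^sup>2 n \<le> n + 1\<close> once \<open>2 (t / 3) + (t / 3)\<^sup>2 \<le> 1\<close>. As every \<open>\<epsilon>\<^bsub>k\<^esub>\<close> with \<open>k \<ge> 1\<close> is strictly
  positive, the lower bound demanded of \<open>d\<^bsub>n+1\<^esub>\<close> lies strictly below this growth rate.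
\<close>
lemma admissible_geometric_root:
  assumes t: "0 < t" "t < 1"
  shows "admissible (\<lambda>k. t * geometric k) root_seq root_seq"
proof -
  have le: "t * geometric k \<le> t / 3" for k
  proof (cases k)
    case (Suc j)
    have "(1::real) \<le> 3 ^ j" by simp
    then show ?thesis using Suc t by (simp add: geometric_def field_simps)
  qed (use t in \<open>simp add: geometric_def\<close>)
  have sup: "(SUP n\<in>{1..}. t * geometric n) = t / 3"
  proof (rule cSup_eq_maximum)
    show "t / 3 \<in> (\<lambda>n. t * geometric n) ` {1..}"
      by (rule image_eqI[of _ _ 1]) (auto simp: geometric_def)
  qed (use le in auto)
  have step: "(1 + t / 3 / real n) * sqrt (real n) \<le> sqrt (real (n + 1))" if n: "n \<ge> 1" for n
  proof (rule real_le_rsqrt)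
    have "t / 3 * (t / 3) \<le> (1 / 3) * (1 / 3)"
      using t by (intro mult_mono) auto
    then have "2 * (t / 3) + t / 3 * (t / 3) \<le> 1"
      using t by linarith
    moreover have "(t / 3 * (t / 3)) / real n \<le> t / 3 * (t / 3)"
      using n t by (simp add: field_simps)
    moreover have "((1 + t / 3 / real n) * sqrt (real n))\<^sup>2 = real n + 2 * (t / 3) + (t / 3 * (t / 3)) / real n"
      using n by (simp add: power_mult_distrib power2_eq_square field_simps)
    ultimately show "((1 + t / 3 / real n) * sqrt (real n))\<^sup>2 \<le> real (n + 1)"
      by simp
  qed
  have strict: "sqrt (real n) * ((1 + t * geometric (k - 1) / real n) / (1 + t * geometric k / real (n + 2)))
      < sqrt (real (n + 1))" if n: "n \<ge> 1" and k: "k \<in> {1..n + 1}" for n k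
  proof -
    have "0 < t * geometric k"
      using t k by (simp add: geometric_def)
    then have "1 < 1 + t * geometric k / real (n + 2)"
      by simp
    moreover have num: "0 < 1 + t * geometric (k - 1) / real n"
      using t n by (intro add_pos_nonneg) (auto simp: geometric_def)
    ultimately have "(1 + t * geometric (k - 1) / real n) / (1 + t * geometric k / real (n + 2))
        < 1 + t * geometric (k - 1) / real n"
      by (simp add: divide_less_eq mult_less_cancel_left1)
    also have "\<dots> \<le> 1 + t / 3 / real n"
      using le by (intro add_left_mono divide_right_mono) auto
    finally have "sqrt (real n) * ((1 + t * geometric (k - 1) / real n) / (1 + t * geometric k / real (n + 2)))
        < sqrt (real n) * (1 + t / 3 / real n)"
      using n by (intro mult_strict_left_mono) auto
    also have "\<dots> \<le> sqrt (real (n + 1))"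
      using step[OF n] by (simp only: mult.commute)
    finally show ?thesis .
  qed
  have "(\<lambda>n. sqrt (real n) / real n) = (\<lambda>n. sqrt (inverse (real n)))"
    by (intro ext) (simp add: sqrt_divide_self_eq real_sqrt_inverse)
  then have "(\<lambda>n. sqrt (real n) / real n) \<longlonglongrightarrow> 0"
    using tendsto_real_sqrt[OF lim_inverse_n] by simp
  then show ?thesis
    unfolding admissible_def sup root_seq_def
    using t le strict step by (auto simp: geometric_def[of 0] intro!: bdd_aboveI[of _ "t / 3"])
      (auto simp: geometric_def)
qed

definition entry_const :: "nat \<Rightarrow> real" where
  "entry_const n = (sqrt (real n) - sqrt (real (n - 1))) / real n"

definition entry_slope :: "nat \<Rightarrow> nat \<Rightarrow> real" where
  "entry_slope k n = geometric k * (sqrt (real n) / (real n * real (n + 1)))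
     - geometric (k - 1) * (sqrt (real (n - 1)) / (real (n - 1) * real n))"

text \<open>
  In the first block the subtracted terms vanish, so that one formula serves all blocks.
\<close>
lemma entry_affine:
  assumes "(k, n) \<in> block_places"
  shows "entry (\<lambda>k. t * geometric k) root_seq k n = entry_const n + t * entry_slope k n"
proof (cases "n = 1")
  case True
  then show ?thesis
    using assms by (auto simp: block_places_def entry_def root_seq_def entry_const_def entry_slope_def)
next
  case False
  then have "n \<ge> 2" using assms by (auto simp: block_places_def)
  then show ?thesis
    by (simp add: entry_def Let_def root_seq_def entry_const_def entry_slope_def algebra_simps)
qed

text \<open>
  In this form the constant term is visibly decreasing in \<open>n\<close>.
\<close>
lemma entry_const_eq: "n \<ge> 1 \<Longrightarrow> entry_const n = 1 / (real n * (sqrt (real n) + sqrt (real (n - 1))))"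
proof -
  assume n: "n \<ge> 1"
  have "(sqrt (real n) - sqrt (real (n - 1))) * (sqrt (real n) + sqrt (real (n - 1))) = 1"
    using n by (simp add: algebra_simps of_nat_diff)
  moreover have "0 < sqrt (real n) + sqrt (real (n - 1))"
    using n by (intro add_pos_nonneg) auto
  ultimately show ?thesis
    using n unfolding entry_const_def by (simp add: divide_simps)
qed

lemma entry_const_decreasing:
  assumes "1 \<le> m" and "m < n"
  shows "entry_const n < entry_const m"
proof -
  have "real m * (sqrt (real m) + sqrt (real (m - 1))) < real n * (sqrt (real n) + sqrt (real (n - 1)))"
    using assms by (intro mult_strict_mono add_less_le_mono) auto
  moreover have "0 < real m * (sqrt (real m) + sqrt (real (m - 1)))"
    using assms by (intro mult_pos_pos add_pos_nonneg) auto
  ultimately show ?thesis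
    using assms by (simp add: entry_const_eq frac_less2)
qed

text \<open>
  A block with two different places has \<open>n \<ge> 2\<close>. For \<open>k \<ge> 2\<close> its slope is \<open>1 / 3\<^sup>k\<^sup>-\<^sup>1\<close> times a negative
  number that depends on \<open>n\<close> only; for \<open>k = 1\<close> the slope is positive because \<open>\<epsilon>\<^bsub>0\<^esub> = 0\<close>.
\<close>
lemma entry_slope_inj:
  assumes j: "(j, n) \<in> block_places" and k: "(k, n) \<in> block_places" and "j < k"
  shows "entry_slope j n \<noteq> entry_slope k n"
proof -
  define x where "x = sqrt (real n) / (real n * real (n + 1))"
  define y where "y = sqrt (real (n - 1)) / (real (n - 1) * real n)"
  have n: "n \<ge> 2"
    using assms by (auto simp: block_places_def)
  have x: "0 < x" using n by (simp add: x_def)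
  have x': "x = 1 / (sqrt (real n) * real (n + 1))" and y': "y = 1 / (sqrt (real (n - 1)) * real n)"
    using n by (simp_all add: x_def y_def divide_simps)
  have "x \<le> y"
    unfolding x' y' using n by (intro divide_left_mono mult_mono) (auto intro!: mult_pos_pos)
  then have neg: "x / 3 - y < 0" using x by simp
  have slope: "entry_slope i n = (x / 3 - y) / 3 ^ (i - 1)" if "i \<ge> 2" for i
  proof -
    obtain l where "i = Suc (Suc l)" using \<open>i \<ge> 2\<close> by (metis add_2_eq_Suc le_Suc_ex)
    moreover have "entry_slope i n = geometric i * x - geometric (i - 1) * y"
      by (simp only: entry_slope_def x_def y_def)
    ultimately show ?thesis
      by (simp add: geometric_def field_simps)
  qed
  have sk: "entry_slope k n = (x / 3 - y) / 3 ^ (k - 1)"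
    using assms by (intro slope) (auto simp: block_places_def)
  show ?thesis
  proof (cases "j = 1")
    case True
    then have "entry_slope j n = x / 3"
      by (simp add: entry_slope_def geometric_def x_def)
    then have "0 < entry_slope j n"
      using x by simp
    moreover have "entry_slope k n < 0"
      unfolding sk using neg by (simp add: divide_less_0_iff)
    ultimately show ?thesis by linarith
  next
    case False
    then have "entry_slope j n = (x / 3 - y) / 3 ^ (j - 1)"
      using j by (intro slope) (auto simp: block_places_def)
    moreover have "(3::real) ^ (j - 1) \<noteq> 3 ^ (k - 1)"
      using j \<open>j < k\<close> by (auto simp: block_places_def)
    ultimately show ?thesis
      using less_imp_neq[OF neg] unfolding sk by (metis divide_cancel_left)
  qed
qed

text \<open>
  Two different affine functions of \<open>t\<close> agree at most once, and the entries are different functions: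
  the constant terms separate the blocks and the slopes separate the places of a block.
\<close>
lemma coincidence_set_countable:
  assumes kn: "(k, n) \<in> block_places" and lm: "(l, m) \<in> block_places" and ne: "(k, n) \<noteq> (l, m)"
  shows "countable {t. entry (\<lambda>k. t * geometric k) root_seq k n
    = entry (\<lambda>k. t * geometric k) root_seq l m}"
proof -
  have "\<not> (entry_const n = entry_const m \<and> entry_slope k n = entry_slope l m)"
  proof
    assume eq: "entry_const n = entry_const m \<and> entry_slope k n = entry_slope l m"
    then have "n = m"
      using entry_const_decreasing[of n m] entry_const_decreasing[of m n] kn lm
      by (cases n m rule: linorder_cases) (auto simp: block_places_def)
    then show False
      using eq ne entry_slope_inj[of k n l] entry_slope_inj[of l n k] kn lm
      by (cases k l rule: linorder_cases) auto
  qed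
  then have "t = (entry_const m - entry_const n) / (entry_slope k n - entry_slope l m)"
    if "entry_const n + t * entry_slope k n = entry_const m + t * entry_slope l m" for t
  proof -
    have "t * (entry_slope k n - entry_slope l m) = entry_const m - entry_const n"
      using that by (simp add: algebra_simps)
    moreover from this have "entry_slope k n - entry_slope l m \<noteq> 0"
      using \<open>\<not> (entry_const n = entry_const m \<and> entry_slope k n = entry_slope l m)\<close> by auto
    ultimately show ?thesis
      by (simp add: eq_divide_eq)
  qed
  then have "{t. entry_const n + t * entry_slope k n = entry_const m + t * entry_slope l m}
      \<subseteq> {(entry_const m - entry_const n) / (entry_slope k n - entry_slope l m)}"
    by blast
  then show ?thesis
    unfolding entry_affine[OF kn] entry_affine[OF lm] using countable_subset by blast
qed

lemma uncountable_distinct_parameters: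
  "uncountable {t. 0 < t \<and> t < 1 \<and>
     inj_on (\<lambda>(k, n). entry (\<lambda>k. t * geometric k) root_seq k n) block_places}"
proof -
  let ?E = "\<lambda>t (k, n). entry (\<lambda>k. t * geometric k) root_seq k n"
  define B where "B = (\<Union>(P, Q)\<in>{(P, Q). P \<in> block_places \<and> Q \<in> block_places \<and> P \<noteq> Q}. {t. ?E t P = ?E t Q})"
  have "countable B"
    unfolding B_def by (intro countable_UN) (auto intro: coincidence_set_countable)
  then have "uncountable ({0<..<1} - B)"
    by (intro uncountable_minus_countable) (simp add: uncountable_open_interval)
  moreover have "{0<..<1} - B \<subseteq> {t. 0 < t \<and> t < 1 \<and> inj_on (?E t) block_places}"
    unfolding B_def by (auto simp: inj_on_def)
  ultimately show ?thesis
    using countable_subset by blast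
qed

lemma block_diagonal_op_entry_determined:
  assumes e: "orthonormal_basis e" and "block_diagonal_op e a D" "block_diagonal_op e b D"
    and kn: "(k, n) \<in> block_places"
  shows "a k n = b k n"
proof -
  let ?x = "e (block_index k n)"
  have "complex_of_real (a k n) *\<^sub>C ?x = complex_of_real (b k n) *\<^sub>C ?x"
    using assms by (fastforce simp: block_diagonal_op_def)
  then have "cinner ?x (complex_of_real (a k n) *\<^sub>C ?x) = cinner ?x (complex_of_real (b k n) *\<^sub>C ?x)"
    by simp
  then show ?thesis
    using e by (simp add: cinner_scaleC_right orthonormal_basis_def)
qed

theorem theorem2p10:
  fixes e :: "nat \<Rightarrow> 'a::complex_hilbert"
  assumes "orthonormal_basis e"
  shows "(\<forall>\<epsilon> \<alpha> d. admissible \<epsilon> \<alpha> d \<longrightarrow>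
            (\<forall>(k, n) \<in> block_places. 0 < entry \<epsilon> d k n) \<and>
            (\<exists>D. block_diagonal_op e (entry \<epsilon> d) D \<and> commutator_of_compacts D)) \<and>
         uncountable {D. \<exists>\<epsilon> \<alpha> d. admissible \<epsilon> \<alpha> d \<and> block_diagonal_op e (entry \<epsilon> d) D \<and>
            inj_on (\<lambda>(k, n). entry \<epsilon> d k n) block_places}"
proof (intro conjI allI impI)
  fix \<epsilon> \<alpha> d
  assume adm: "admissible \<epsilon> \<alpha> d"
  show "\<forall>(k, n) \<in> block_places. 0 < entry \<epsilon> d k n"
    using entry_pos[OF adm] by auto
  show "\<exists>D. block_diagonal_op e (entry \<epsilon> d) D \<and> commutator_of_compacts D"
    by (rule block_diagonal_commutator[OF assms adm])
next
  let ?a = "\<lambda>t. entry (\<lambda>k. t * geometric k) root_seq"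
  define G where "G = {t. 0 < t \<and> t < 1 \<and> inj_on (\<lambda>(k, n). ?a t k n) block_places}"
  have "\<forall>t\<in>G. \<exists>D. block_diagonal_op e (?a t) D"
    using block_diagonal_commutator[OF assms admissible_geometric_root] unfolding G_def by blast
  then obtain D where D: "\<And>t. t \<in> G \<Longrightarrow> block_diagonal_op e (?a t) (D t)"
    by metis
  have "inj_on D G"
  proof
    fix s t
    assume st: "s \<in> G" "t \<in> G" "D s = D t"
    have place: "(1, 1) \<in> block_places"
      by (simp add: block_places_def)
    have "?a s 1 1 = ?a t 1 1"
      using block_diagonal_op_entry_determined[OF assms D[OF st(1)] _ place] D[OF st(2)] st(3) by simp
    then show "s = t"
      by (simp add: entry_def root_seq_def geometric_def)
  qed
  moreover have "uncountable G"
    unfolding G_def by (rule uncountable_distinct_parameters)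
  ultimately have "uncountable (D ` G)"
    using countable_image_inj_on by blast
  moreover have "D ` G \<subseteq> {D. \<exists>\<epsilon> \<alpha> d. admissible \<epsilon> \<alpha> d \<and> block_diagonal_op e (entry \<epsilon> d) D \<and>
            inj_on (\<lambda>(k, n). entry \<epsilon> d k n) block_places}"
    using D admissible_geometric_root unfolding G_def by blast
  ultimately show "uncountable {D. \<exists>\<epsilon> \<alpha> d. admissible \<epsilon> \<alpha> d \<and> block_diagonal_op e (entry \<epsilon> d) D \<and>
            inj_on (\<lambda>(k, n). entry \<epsilon> d k n) block_places}"
    using countable_subset by blast
qed

end
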